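(* Let $\mathbf{A}\in\mathbb{R}^{n\times n}$ be a nonzero positive semidefinite matrix. For any $\epsilon,\delta\in(0,1)$, the Frobenius norm estimation algorithm described in the context, run with $s=\lceil 3n\log(2/\delta)/\epsilon^2\rceil$ trials, produces an estimate $\widehat F$ satisfying $$(1-\epsilon)\|\mathbf{A}\|_{\mathrm F}^2\le\widehat F\le(1+\epsilon)\|\mathbf{A}\|_{\mathrm F}^2\quad\text{with probability}\ \ge1-\delta.$$ The algorithm requires $O(n+s)=O(n\log(1/\delta)/\epsilon^2)$ entry queries and arithmetic operations.
   Context: $\|\cdot\|_{\mathrm F}$ is the Frobenius norm, $\operatorname{tr}$ is the trace, $\log$ is the natural logarithm. A positive semidefinite matrix is a real symmetric matrix with $\mathbf{x}^\top\mathbf{A}\mathbf{x}\ge0$ for all $\mathbf{x}$. Algorithm (input $\mathbf{A}$ and number of trials $s$). Read the diagonal of $\mathbf{A}$ and define the distribution $\mathcal{D}(i)=\mathbf{A}_{ii}/\operatorname{tr}(\mathbf{A})$ on $\{1,\dots,n\}$. For $k=1,\dots,s$: sample independent $I,J\sim\mathcal{D}$ (independently of the other trials) and set $X_k=\mathbf{A}_{IJ}^2/(\mathbf{A}_{II}\mathbf{A}_{JJ})$. Return $\widehat F=\operatorname{tr}(\mathbf{A})^2\cdot\frac1s\sum_{k=1}^sX_k$. The matrix is accessed by querying individual entries; each trial is charged one entry query and a constant number of arithmetic operations.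
   Formalization: The bound O(n+s)=O(n log(1/δ)/ε²) is stated for δ ≤ δ₀ with a constant depending on δ₀, for every δ₀<1, because no single constant works as δ→1, where log(1/δ)→0 while n+s≥1. *)

theory Defs
  imports "HOL-Probability.Probability" "Jordan_Normal_Form.Matrix"
begin

definition psd_mat :: "nat \<Rightarrow> real mat \<Rightarrow> bool" where
  "psd_mat n A \<longleftrightarrow> A \<in> carrier_mat n n \<and> transpose_mat A = A \<and>
     (\<forall>x \<in> carrier_vec n. scalar_prod x (A *\<^sub>v x) \<ge> 0)"

definition frobenius_norm :: "real mat \<Rightarrow> real" where
  "frobenius_norm A = sqrt (\<Sum>i<dim_row A. \<Sum>j<dim_col A. (A $$ (i, j))\<^sup>2)"

text \<open>
  Randomized computations with cost accounting: an outcome (x, q, a) is a result x obtained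
  with q matrix entry queries and a arithmetic operations. Sequential composition draws fresh,
  independent randomness and adds up the costs.
\<close>

type_synonym 'a costed = "('a \<times> nat \<times> nat) pmf"

definition ret :: "'a \<Rightarrow> 'a costed" where
  "ret x = return_pmf (x, 0, 0)"

definition andthen :: "'a costed \<Rightarrow> ('a \<Rightarrow> 'b costed) \<Rightarrow> 'b costed" (infixl \<open>\<triangleright>\<close> 54) where
  "m \<triangleright> f = bind_pmf m (\<lambda>(x, q, a). map_pmf (\<lambda>(y, q', a'). (y, q + q', a + a')) (f x))"

definition query :: "real mat \<Rightarrow> nat \<Rightarrow> nat \<Rightarrow> real costed" where
  "query A i j = return_pmf (A $$ (i, j), 1, 0)"

text \<open>Every use of \<open>arith\<close> has a single arithmetic operation as its argument.\<close>

definition arith :: "real \<Rightarrow> real costed" where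
  "arith x = return_pmf (x, 0, 1)"

text \<open>Drawing one sample is charged as c arithmetic operations, c being a constant of the model.\<close>

definition draw :: "nat \<Rightarrow> 'a pmf \<Rightarrow> 'a costed" where
  "draw c p = map_pmf (\<lambda>x. (x, 0, c)) p"

primrec traverse :: "('a \<Rightarrow> 'b costed) \<Rightarrow> 'a list \<Rightarrow> 'b list costed" where
  "traverse f [] = ret []"
| "traverse f (x # xs) = f x \<triangleright> (\<lambda>y. traverse f xs \<triangleright> (\<lambda>ys. ret (y # ys)))"

primrec add_up :: "real list \<Rightarrow> real costed" where
  "add_up [] = ret 0"
| "add_up (x # xs) = add_up xs \<triangleright> (\<lambda>t. arith (x + t))"

text \<open>
  One trial: d is the stored diagonal, D the sampling distribution. The two draws are
  independent, and only the entry (I, J) is queried.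
\<close>

definition trial :: "nat \<Rightarrow> real mat \<Rightarrow> real list \<Rightarrow> nat pmf \<Rightarrow> real costed" where
  "trial c A d D =
     draw c D \<triangleright> (\<lambda>I.
     draw c D \<triangleright> (\<lambda>J.
     query A I J \<triangleright> (\<lambda>a.
     arith (a\<^sup>2) \<triangleright> (\<lambda>u.
     arith (d ! I * d ! J) \<triangleright> (\<lambda>v.
     arith (u / v))))))"

text \<open>
  Row and column indices are 0, ..., n - 1. For a nonzero positive semidefinite A the list
  \<open>zip [0..<n] w\<close> satisfies \<open>pmf_of_list_wf\<close>, so that D gives i the probability
  A(i, i) / tr(A).
\<close>

definition frobenius_estimate :: "nat \<Rightarrow> nat \<Rightarrow> real mat \<Rightarrow> nat \<Rightarrow> real costed" where
  "frobenius_estimate c n A s =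
     traverse (\<lambda>i. query A i i) [0..<n] \<triangleright> (\<lambda>d.
     add_up d \<triangleright> (\<lambda>tr.
     traverse (\<lambda>x. arith (x / tr)) d \<triangleright> (\<lambda>w.
     traverse (\<lambda>_. trial c A d (pmf_of_list (zip [0..<n] w))) [0..<s] \<triangleright> (\<lambda>X.
     add_up X \<triangleright> (\<lambda>S.
     arith (S / real s) \<triangleright> (\<lambda>m.
     arith (tr\<^sup>2) \<triangleright> (\<lambda>t2.
     arith (t2 * m))))))))"

definition num_trials :: "nat \<Rightarrow> real \<Rightarrow> real \<Rightarrow> nat" where
  "num_trials n \<epsilon> \<delta> = nat \<lceil>3 * real n * ln (2 / \<delta>) / \<epsilon>\<^sup>2\<rceil>"

end

theory Submission
  imports Defs
begin

text \<open>
  A trial has expectation \<open>\<mu> = \<parallel>A\<parallel>\<^sub>F\<^sup>2 / tr(A)\<^sup>2\<close>. The 2 by 2 principal minors of A being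
  nonnegative, its values lie in [0, 1], and Cauchy--Schwarz applied to the diagonal gives
  \<open>\<mu> \<ge> 1 / n\<close>. The multiplicative Chernoff bound then leaves a failure probability of at most
  \<open>2 exp (- \<epsilon>\<^sup>2 s \<mu> / 3) \<le> \<delta>\<close>.
\<close>

section \<open>The multiplicative Chernoff bound\<close>

text \<open>Independence of the draws makes the moment generating function of their sum a power.
  With nonnegative integrals the product splits without integrability side conditions.\<close>

lemma nn_integral_exp_sum_list_replicate_pmf:
  "(\<integral>\<^sup>+xs. ennreal (exp (t * sum_list xs)) \<partial>replicate_pmf s p)
     = (\<integral>\<^sup>+x. ennreal (exp (t * x)) \<partial>measure_pmf p) ^ s"
  by (induction s)
    (simp_all add: distrib_left exp_add ennreal_mult' nn_integral_cmult nn_integral_multc)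

text \<open>By convexity, the graph of \<open>exp (t * x)\<close> over [0, 1] lies below its
  chord.\<close>

lemma exp_le_linear_interpolation:
  fixes t x :: real
  assumes "0 \<le> x" "x \<le> 1"
  shows "exp (t * x) \<le> 1 + x * (exp t - 1)"
  using convex_onD[OF exp_convex, of x 0 t] assms by (simp add: algebra_simps)

text \<open>Integrating the chord bound leaves only the mean of p; then 1 + y \<le> exp y is
  applied. The sign of t is free, as the two tails need opposite signs.\<close>

lemma nn_integral_exp_le:
  fixes p :: "real pmf"
  assumes "set_pmf p \<subseteq> {0..1}"
  shows "(\<integral>\<^sup>+x. ennreal (exp (t * x)) \<partial>measure_pmf p)
           \<le> ennreal (exp (measure_pmf.expectation p (\<lambda>x. x) * (exp t - 1)))"
proof -
  have int: "integrable (measure_pmf p) (\<lambda>x. x)"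
    using assms by (intro measure_pmf.integrable_const_bound[where B = 1])
      (auto simp: AE_measure_pmf_iff)
  have ae: "AE x in measure_pmf p. exp (t * x) \<le> 1 + x * (exp t - 1)"
    using assms by (auto simp: AE_measure_pmf_iff intro!: exp_le_linear_interpolation)
  have "(\<integral>\<^sup>+x. ennreal (exp (t * x)) \<partial>measure_pmf p)
      \<le> (\<integral>\<^sup>+x. ennreal (1 + x * (exp t - 1)) \<partial>measure_pmf p)"
    using ae by (intro nn_integral_mono_AE) (auto elim!: eventually_mono intro: ennreal_leI)
  also have "\<dots> = ennreal (\<integral>x. 1 + x * (exp t - 1) \<partial>measure_pmf p)"
    using ae int by (intro nn_integral_eq_integral)
      (auto elim!: eventually_mono intro: order_trans[OF exp_ge_zero])
  also have "(\<integral>x. 1 + x * (exp t - 1) \<partial>measure_pmf p)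
      = 1 + measure_pmf.expectation p (\<lambda>x. x) * (exp t - 1)"
    using int by simp
  also have "ennreal \<dots> \<le> ennreal (exp (measure_pmf.expectation p (\<lambda>x. x) * (exp t - 1)))"
    by (intro ennreal_leI exp_ge_add_one_self)
  finally show ?thesis .
qed

text \<open>Markov's inequality: on H the variable \<open>exp (t * sum_list xs - u)\<close> is at
  least 1, so its integral bounds the probability of H. Positive t serves the upper tail, negative t
  the lower one.\<close>

lemma chernoff_exponential:
  fixes p :: "real pmf"
  assumes p: "set_pmf p \<subseteq> {0..1}"
    and H: "\<And>xs. xs \<in> H \<Longrightarrow> u \<le> t * sum_list xs"
  shows "measure_pmf.prob (replicate_pmf s p) H
           \<le> exp (real s * measure_pmf.expectation p (\<lambda>x. x) * (exp t - 1) - u)"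
proof -
  let ?R = "measure_pmf (replicate_pmf s p)" and ?\<mu> = "measure_pmf.expectation p (\<lambda>x. x)"
  have "emeasure ?R H = (\<integral>\<^sup>+xs. indicator H xs \<partial>?R)"
    by simp
  also have "\<dots> \<le> (\<integral>\<^sup>+xs. ennreal (exp (- u)) * ennreal (exp (t * sum_list xs)) \<partial>?R)"
    using H by (intro nn_integral_mono)
      (auto simp: indicator_def ennreal_mult'[symmetric] exp_add[symmetric])
  also have "\<dots> = ennreal (exp (- u)) * (\<integral>\<^sup>+x. ennreal (exp (t * x)) \<partial>measure_pmf p) ^ s"
    by (simp add: nn_integral_cmult nn_integral_exp_sum_list_replicate_pmf)
  also have "\<dots> \<le> ennreal (exp (- u)) * ennreal (exp (?\<mu> * (exp t - 1))) ^ s"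
    by (intro mult_left_mono power_mono nn_integral_exp_le p) auto
  also have "\<dots> = ennreal (exp (real s * ?\<mu> * (exp t - 1) - u))"
    by (simp add: ennreal_power exp_of_nat_mult[symmetric] ennreal_mult'[symmetric]
        exp_add[symmetric] algebra_simps)
  finally show ?thesis
    by (simp add: measure_pmf.emeasure_eq_measure)
qed

text \<open>Both sides vanish at 0, and the derivative of the difference is y^2 / ((1 + y) (2 +
  y)^2), which is nonnegative.\<close>

lemma ln_add_one_ge_rational:
  fixes x :: real
  assumes "0 \<le> x"
  shows "2 * x / (2 + x) \<le> ln (1 + x)"
proof -
  let ?f = "\<lambda>x::real. ln (1 + x) - 2 * x / (2 + x)"
  have "?f 0 \<le> ?f x"
  proof (rule DERIV_nonneg_imp_nondecreasing[OF assms])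
    fix y :: real
    assume "0 \<le> y"
    then have "(?f has_real_derivative 1 / (1 + y) - (2 * (2 + y) - 2 * y) / ((2 + y) * (2 + y))) (at y)"
      by (auto intro!: derivative_eq_intros)
    moreover have "(2 * (2 + y) - 2 * y) / ((2 + y) * (2 + y)) \<le> 1 / (1 + y)"
      using \<open>0 \<le> y\<close> by (simp add: divide_simps) (simp add: algebra_simps)
    ultimately show "\<exists>z. (?f has_real_derivative z) (at y) \<and> 0 \<le> z"
      by (meson diff_ge_0_iff_ge)
  qed
  then show ?thesis
    by simp
qed

text \<open>The rational bound on the logarithm gives - x^2 / (2 + x), and 2 + x \<le> 3. This is
  the source of the constant 3 in the number of trials.\<close>

lemma chernoff_upper_exponent:
  fixes x :: real
  assumes "0 \<le> x" "x \<le> 1"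
  shows "x - (1 + x) * ln (1 + x) \<le> - x\<^sup>2 / 3"
proof -
  have "x + x\<^sup>2 / 3 \<le> x + x\<^sup>2 / (2 + x)"
    using assms by (intro add_left_mono divide_left_mono) auto
  also have "\<dots> = (1 + x) * (2 * x / (2 + x))"
    using assms by (simp add: field_simps power2_eq_square)
  also have "\<dots> \<le> (1 + x) * ln (1 + x)"
    using assms by (intro mult_left_mono ln_add_one_ge_rational) auto
  finally show ?thesis
    by simp
qed

text \<open>The product of 1 - x + x^2 / 2 and 1 + x + x^2 / 2 is 1 + x^4 / 4, hence at least 1,
  while the second factor is at most exp x.\<close>

lemma exp_minus_le_quadratic:
  fixes x :: real
  assumes "0 \<le> x"
  shows "exp (- x) \<le> 1 - x + x\<^sup>2 / 2"
proof -
  have pos: "0 \<le> 1 - x + x\<^sup>2 / 2"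
    using zero_le_power2[of "x - 1"] unfolding power2_diff by simp
  have "1 \<le> 1 + x ^ 4 / 4"
    by simp
  also have "\<dots> = (1 - x + x\<^sup>2 / 2) * (1 + x + x\<^sup>2 / 2)"
    by (simp add: field_simps power2_eq_square power4_eq_xxxx)
  also have "\<dots> \<le> (1 - x + x\<^sup>2 / 2) * exp x"
    using pos assms by (intro mult_left_mono exp_lower_Taylor_quadratic)
  finally show ?thesis
    by (simp add: exp_minus field_simps)
qed

lemma chernoff_multiplicative:
  fixes p :: "real pmf"
  assumes p: "set_pmf p \<subseteq> {0..1}" and \<epsilon>: "0 \<le> \<epsilon>" "\<epsilon> \<le> 1"
  defines "\<mu> \<equiv> measure_pmf.expectation p (\<lambda>x. x)"
  shows "measure_pmf.prob (replicate_pmf s p)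
           {xs. (1 - \<epsilon>) * (s * \<mu>) \<le> sum_list xs \<and> sum_list xs \<le> (1 + \<epsilon>) * (s * \<mu>)}
         \<ge> 1 - 2 * exp (- (\<epsilon>\<^sup>2 * (s * \<mu>) / 3))"
proof -
  let ?R = "replicate_pmf s p"
  let ?hi = "{xs. (1 + \<epsilon>) * (s * \<mu>) < sum_list xs}"
  let ?lo = "{xs. sum_list xs < (1 - \<epsilon>) * (s * \<mu>)}"
  have "0 \<le> \<mu>"
    unfolding \<mu>_def using p by (intro integral_nonneg_AE) (auto simp: AE_measure_pmf_iff)
  then have m: "0 \<le> s * \<mu>"
    by simp
  \<comment> \<open>The parameter t = ln (1 + \<epsilon>) minimizes the exponent of the upper
    tail.\<close>
  have "measure_pmf.prob ?R ?hi
      \<le> exp (s * \<mu> * (exp (ln (1 + \<epsilon>)) - 1) - ln (1 + \<epsilon>) * ((1 + \<epsilon>) * (s * \<mu>)))"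
    unfolding \<mu>_def using p \<epsilon> by (intro chernoff_exponential) (auto intro!: mult_left_mono)
  also have "\<dots> = exp (s * \<mu> * (\<epsilon> - (1 + \<epsilon>) * ln (1 + \<epsilon>)))"
    using \<epsilon> by (simp add: algebra_simps)
  also have "\<dots> \<le> exp (s * \<mu> * (- \<epsilon>\<^sup>2 / 3))"
    unfolding exp_le_cancel_iff using m \<epsilon> by (intro mult_left_mono chernoff_upper_exponent)
  finally have hi: "measure_pmf.prob ?R ?hi \<le> exp (- (\<epsilon>\<^sup>2 * (s * \<mu>) / 3))"
    by (simp add: mult_ac)
  \<comment> \<open>The parameter t = - \<epsilon> replaces the optimal ln (1 - \<epsilon>): it
    makes sense at \<epsilon> = 1 too and still gives - \<epsilon>^2 / 2 as the factor of s
    \<mu>.\<close>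
  have "measure_pmf.prob ?R ?lo
      \<le> exp (s * \<mu> * (exp (- \<epsilon>) - 1) - (- \<epsilon>) * ((1 - \<epsilon>) * (s * \<mu>)))"
    unfolding \<mu>_def using p \<epsilon> by (intro chernoff_exponential) (auto intro!: mult_left_mono)
  also have "\<dots> = exp (s * \<mu> * (exp (- \<epsilon>) - 1 + \<epsilon> * (1 - \<epsilon>)))"
    by (simp add: algebra_simps)
  also have "\<dots> \<le> exp (s * \<mu> * (- \<epsilon>\<^sup>2 / 3))"
    unfolding exp_le_cancel_iff
  proof (intro mult_left_mono m)
    have "\<epsilon> * (1 - \<epsilon>) = \<epsilon> - \<epsilon>\<^sup>2"
      by (simp add: power2_eq_square right_diff_distrib)
    then show "exp (- \<epsilon>) - 1 + \<epsilon> * (1 - \<epsilon>) \<le> - \<epsilon>\<^sup>2 / 3"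
      using exp_minus_le_quadratic[OF \<epsilon>(1)] zero_le_power2[of \<epsilon>] by linarith
  qed
  finally have lo: "measure_pmf.prob ?R ?lo \<le> exp (- (\<epsilon>\<^sup>2 * (s * \<mu>) / 3))"
    by (simp add: mult_ac)
  have "measure_pmf.prob ?R (?hi \<union> ?lo) \<le> measure_pmf.prob ?R ?hi + measure_pmf.prob ?R ?lo"
    by (intro measure_Un_le) auto
  also have "\<dots> \<le> 2 * exp (- (\<epsilon>\<^sup>2 * (s * \<mu>) / 3))"
    using hi lo by simp
  finally have "1 - 2 * exp (- (\<epsilon>\<^sup>2 * (s * \<mu>) / 3)) \<le> measure_pmf.prob ?R (- (?hi \<union> ?lo))"
    using measure_pmf.prob_compl[of "?hi \<union> ?lo" ?R] by (simp add: Compl_eq_Diff_UNIV)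
  also have "- (?hi \<union> ?lo)
      = {xs. (1 - \<epsilon>) * (s * \<mu>) \<le> sum_list xs \<and> sum_list xs \<le> (1 + \<epsilon>) * (s * \<mu>)}"
    by auto
  finally show ?thesis .
qed

section \<open>Entries of a positive semidefinite matrix\<close>

lemma psd_mat_entry_commute:
  assumes "psd_mat n A" "i < n" "j < n"
  shows "A $$ (i, j) = A $$ (j, i)"
  using assms unfolding psd_mat_def by (metis carrier_matD index_transpose_mat(1))

lemma mult_mat_vec_unit_vec:
  fixes A :: "'a :: semiring_1 mat"
  assumes "A \<in> carrier_mat m n" "j < n"
  shows "A *\<^sub>v unit_vec n j = col A j"
  using assms by (intro eq_vecI) (auto simp: scalar_prod_right_unit)

text \<open>The form of A is evaluated at a combination of two unit vectors, which gives the form of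
  a 2 by 2 principal submatrix. The case i = j is included.\<close>

lemma psd_mat_quadratic_form:
  assumes A: "psd_mat n A" and i: "i < n" and j: "j < n"
  shows "0 \<le> a\<^sup>2 * A $$ (i, i) + 2 * a * b * A $$ (i, j) + b\<^sup>2 * A $$ (j, j)"
proof -
  let ?ei = "unit_vec n i" and ?ej = "unit_vec n j"
  let ?x = "a \<cdot>\<^sub>v ?ei + b \<cdot>\<^sub>v ?ej"
  have C: "A \<in> carrier_mat n n"
    using A by (simp add: psd_mat_def)
  have Ax: "A *\<^sub>v ?x = a \<cdot>\<^sub>v col A i + b \<cdot>\<^sub>v col A j"
    using C i j by (simp add: mult_add_distrib_mat_vec[OF C] mult_mat_vec[OF C]
        mult_mat_vec_unit_vec[OF C])
  have col: "col A i \<in> carrier_vec n" "col A j \<in> carrier_vec n"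
    using C i j by auto
  have "0 \<le> scalar_prod ?x (A *\<^sub>v ?x)"
    using A by (simp add: psd_mat_def)
  also have "\<dots> = a * (a * A $$ (i, i) + b * A $$ (i, j)) + b * (a * A $$ (j, i) + b * A $$ (j, j))"
    using C i j col unfolding Ax
    by (subst add_scalar_prod_distrib[of _ n]) (auto simp: scalar_prod_left_unit)
  finally show ?thesis
    using psd_mat_entry_commute[OF A i j] by (simp add: power2_eq_square algebra_simps)
qed

lemma psd_mat_diag_nonneg:
  assumes "psd_mat n A" "i < n"
  shows "0 \<le> A $$ (i, i)"
  using psd_mat_quadratic_form[OF assms assms(2), of 1 0] by simp

text \<open>At (q, - p) the form equals p (p r - q^2), and at (r, - q) it equals r (p r - q^2), so a
  positive p or r can be cancelled. If both vanish, (1, - q) gives - 2 q^2 \<ge> 0.\<close>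

lemma nonneg_quadratic_form_discriminant:
  fixes p q r :: real
  assumes "\<And>a b. 0 \<le> a\<^sup>2 * p + 2 * a * b * q + b\<^sup>2 * r"
  shows "q\<^sup>2 \<le> p * r"
proof -
  have p: "0 \<le> p" and r: "0 \<le> r"
    using assms[of 1 0] assms[of 0 1] by auto
  consider "0 < p" | "0 < r" | "p = 0" "r = 0"
    using p r by fastforce
  then show ?thesis
  proof cases
    case 1
    have "0 \<le> p * (p * r - q\<^sup>2)"
      using assms[of q "- p"] by (simp add: power2_eq_square algebra_simps)
    with 1 show ?thesis
      by (simp add: zero_le_mult_iff)
  next
    case 2
    have "0 \<le> r * (p * r - q\<^sup>2)"
      using assms[of r "- q"] by (simp add: power2_eq_square algebra_simps)
    with 2 show ?thesis
      by (simp add: zero_le_mult_iff)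
  next
    case 3
    then show ?thesis
      using assms[of 1 "- q"] by (simp add: power2_eq_square)
  qed
qed

text \<open>This bounds a trial by 1, and it makes an entry vanish whenever one of its two diagonal
  entries does.\<close>

lemma psd_mat_entry_square_le:
  assumes "psd_mat n A" "i < n" "j < n"
  shows "(A $$ (i, j))\<^sup>2 \<le> A $$ (i, i) * A $$ (j, j)"
  by (intro nonneg_quadratic_form_discriminant psd_mat_quadratic_form[OF assms])

text \<open>A zero trace would make every diagonal entry zero, and the bound on the minors would
  then make every entry zero.\<close>

lemma psd_mat_trace_pos:
  assumes A: "psd_mat n A" and nz: "A \<noteq> 0\<^sub>m n n"
  shows "0 < (\<Sum>i<n. A $$ (i, i))"
proof (rule ccontr)
  assume "\<not> 0 < (\<Sum>i<n. A $$ (i, i))"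
  moreover have "0 \<le> (\<Sum>i<n. A $$ (i, i))"
    using psd_mat_diag_nonneg[OF A] by (intro sum_nonneg) auto
  ultimately have "(\<Sum>i<n. A $$ (i, i)) = 0"
    by linarith
  then have "\<forall>i<n. A $$ (i, i) = 0"
    using psd_mat_diag_nonneg[OF A] by (subst (asm) sum_nonneg_eq_0_iff) auto
  then have "\<forall>i<n. \<forall>j<n. A $$ (i, j) = 0"
    using psd_mat_entry_square_le[OF A] by fastforce
  then have "A = 0\<^sub>m n n"
    using A by (intro eq_matI) (auto simp: psd_mat_def)
  with nz show False ..
qed

lemma frobenius_norm_square:
  assumes "A \<in> carrier_mat n n"
  shows "(frobenius_norm A)\<^sup>2 = (\<Sum>i<n. \<Sum>j<n. (A $$ (i, j))\<^sup>2)"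
  using assms unfolding frobenius_norm_def by (subst real_sqrt_pow2) (auto intro!: sum_nonneg)

text \<open>Cauchy--Schwarz of the diagonal against the all-ones vector, followed by adding the
  off-diagonal squares. It yields \<mu> \<ge> 1 / n.\<close>

lemma trace_square_le_frobenius_norm:
  assumes C: "A \<in> carrier_mat n n"
  shows "(\<Sum>i<n. A $$ (i, i))\<^sup>2 \<le> n * (frobenius_norm A)\<^sup>2"
proof -
  have "(\<Sum>i<n. A $$ (i, i))\<^sup>2 \<le> n * (\<Sum>i<n. (A $$ (i, i))\<^sup>2)"
    using Cauchy_Schwarz_ineq_sum[of "\<lambda>_. 1" "\<lambda>i. A $$ (i, i)" "{..<n}"] by simp
  also have "(\<Sum>i<n. (A $$ (i, i))\<^sup>2) \<le> (\<Sum>i<n. \<Sum>j<n. (A $$ (i, j))\<^sup>2)"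
    by (intro sum_mono member_le_sum) auto
  finally show ?thesis
    by (simp add: frobenius_norm_square[OF C] mult_left_mono)
qed

section \<open>Outputs of the algorithm\<close>

text \<open>Forgetting the costs commutes with sequencing, so the law of the output can be computed
  phase by phase without them.\<close>

lemma map_fst_andthen:
  "map_pmf fst (m \<triangleright> f) = bind_pmf (map_pmf fst m) (\<lambda>x. map_pmf fst (f x))"
  by (auto simp: andthen_def map_bind_pmf bind_map_pmf map_pmf_comp split_beta
      intro!: bind_pmf_cong)

lemma map_fst_primitives [simp]:
  "map_pmf fst (ret x) = return_pmf x"
  "map_pmf fst (query A i j) = return_pmf (A $$ (i, j))"
  "map_pmf fst (arith y) = return_pmf y"
  "map_pmf fst (draw c p) = p"
  by (simp_all add: ret_def query_def arith_def draw_def map_pmf_comp)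

lemma map_fst_traverse_deterministic:
  assumes "\<And>x. map_pmf fst (f x) = return_pmf (g x)"
  shows "map_pmf fst (traverse f xs) = return_pmf (map g xs)"
  by (induction xs) (simp_all add: map_fst_andthen assms bind_return_pmf)

text \<open>Each run in the sequence draws fresh randomness, so the outputs are independent copies
  of one law.\<close>

lemma map_fst_traverse_const:
  "map_pmf fst (traverse (\<lambda>_. m) xs) = replicate_pmf (length xs) (map_pmf fst m)"
  by (induction xs) (simp_all add: map_fst_andthen)

lemma map_fst_add_up: "map_pmf fst (add_up xs) = return_pmf (sum_list xs)"
  by (induction xs) (simp_all add: map_fst_andthen bind_return_pmf)

lemma map_fst_trial:
  "map_pmf fst (trial c A d D)
     = map_pmf (\<lambda>(i, j). (A $$ (i, j))\<^sup>2 / (d ! i * d ! j)) (pair_pmf D D)"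
  by (simp add: trial_def map_fst_andthen bind_return_pmf pair_pmf_def map_bind_pmf)

section \<open>The law of one trial and of the estimate\<close>

definition diagonal_pmf :: "nat \<Rightarrow> real mat \<Rightarrow> nat pmf" where
  "diagonal_pmf n A =
     pmf_of_list (zip [0..<n] (map (\<lambda>i. A $$ (i, i) / (\<Sum>i<n. A $$ (i, i))) [0..<n]))"

text \<open>The list lookups mirror the stored diagonal; thus the output law can be identified for
  every A, before the sampled indices are known to lie below n.\<close>

definition trial_pmf :: "nat \<Rightarrow> real mat \<Rightarrow> real pmf" where
  "trial_pmf n A = map_pmf (\<lambda>(i, j). (A $$ (i, j))\<^sup>2 /
       (map (\<lambda>i. A $$ (i, i)) [0..<n] ! i * map (\<lambda>i. A $$ (i, i)) [0..<n] ! j))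
     (pair_pmf (diagonal_pmf n A) (diagonal_pmf n A))"

text \<open>All phases but the trials are deterministic and collapse to their values, leaving a
  function of s independent trial values.\<close>

lemma map_fst_frobenius_estimate:
  "map_pmf fst (frobenius_estimate c n A s)
     = map_pmf (\<lambda>X. (\<Sum>i<n. A $$ (i, i))\<^sup>2 * (sum_list X / s)) (replicate_pmf s (trial_pmf n A))"
proof -
  have tr: "sum_list (map (\<lambda>i. A $$ (i, i)) [0..<n]) = (\<Sum>i<n. A $$ (i, i))"
    by (simp add: interv_sum_list_conv_sum_set_nat atLeast0LessThan)
  have diag: "map_pmf fst (traverse (\<lambda>i. query A i i) [0..<n])
      = return_pmf (map (\<lambda>i. A $$ (i, i)) [0..<n])"
    by (intro map_fst_traverse_deterministic) simp
  have weights: "map_pmf fst (traverse (\<lambda>x. arith (x / t)) d) = return_pmf (map (\<lambda>x. x / t) d)"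
    for t d by (intro map_fst_traverse_deterministic) simp
  show ?thesis
    unfolding frobenius_estimate_def map_fst_andthen diag weights map_fst_traverse_const
      map_fst_add_up map_fst_trial bind_return_pmf tr map_fst_primitives
    by (simp add: trial_pmf_def diagonal_pmf_def map_pmf_def comp_def)
qed

context
  fixes n :: nat and A :: "real mat" and tr :: real
  assumes A: "psd_mat n A" and nz: "A \<noteq> 0\<^sub>m n n"
  defines "tr \<equiv> \<Sum>i<n. A $$ (i, i)"
begin

lemma diagonal_pmf_of_list_wf:
  "pmf_of_list_wf (zip [0..<n] (map (\<lambda>i. A $$ (i, i) / tr) [0..<n]))"
proof (rule pmf_of_list_wfI)
  have tr: "0 < tr"
    unfolding tr_def by (rule psd_mat_trace_pos[OF A nz])
  show "0 \<le> x" if "x \<in> set (map snd (zip [0..<n] (map (\<lambda>i. A $$ (i, i) / tr) [0..<n])))" for x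
    using that tr psd_mat_diag_nonneg[OF A] by auto
  show "sum_list (map snd (zip [0..<n] (map (\<lambda>i. A $$ (i, i) / tr) [0..<n]))) = 1"
    using tr by (simp add: interv_sum_list_conv_sum_set_nat atLeast0LessThan
        sum_divide_distrib[symmetric] tr_def[symmetric])
qed

lemma set_diagonal_pmf: "set_pmf (diagonal_pmf n A) \<subseteq> {..<n}"
  using set_pmf_of_list[OF diagonal_pmf_of_list_wf] by (auto simp: diagonal_pmf_def tr_def)

lemma pmf_diagonal_pmf:
  assumes "i < n"
  shows "pmf (diagonal_pmf n A) i = A $$ (i, i) / tr"
proof -
  \<comment> \<open>\<open>pmf_of_list\<close> adds the weights of all pairs with key i; the keys
    are distinct, so one term survives.\<close>
  have "pmf (diagonal_pmf n A) i
      = (\<Sum>k\<leftarrow>[0..<n]. if k = i then A $$ (k, k) / tr else 0)"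
    unfolding diagonal_pmf_def pmf_pmf_of_list[OF diagonal_pmf_of_list_wf[unfolded tr_def]]
    by (simp add: zip_map2 zip_same_conv_map sum_list_map_filter' comp_def tr_def cong: if_cong)
  also have "\<dots> = A $$ (i, i) / tr"
    using assms by (simp add: interv_sum_list_conv_sum_set_nat)
  finally show ?thesis .
qed

lemma set_trial_pmf: "set_pmf (trial_pmf n A) \<subseteq> {0..1}"
proof
  fix x
  assume "x \<in> set_pmf (trial_pmf n A)"
  then obtain i j where "i \<in> set_pmf (diagonal_pmf n A)" "j \<in> set_pmf (diagonal_pmf n A)"
    and x: "x = (A $$ (i, j))\<^sup>2 /
      (map (\<lambda>i. A $$ (i, i)) [0..<n] ! i * map (\<lambda>i. A $$ (i, i)) [0..<n] ! j)"
    by (auto simp: trial_pmf_def)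
  then have ij: "i < n" "j < n"
    using set_diagonal_pmf by auto
  have "0 \<le> A $$ (i, i) * A $$ (j, j)"
    using psd_mat_diag_nonneg[OF A] ij by simp
  \<comment> \<open>\<open>divide_le_eq_1\<close> also covers a zero denominator, where the quotient
    is 0 by convention.\<close>
  then show "x \<in> {0..1}"
    using psd_mat_entry_square_le[OF A ij] by (auto simp: x ij divide_le_eq_1)
qed

text \<open>Importance sampling: the probability of drawing (i, j) has the numerator A(i, i) A(j,
  j), which cancels the denominator of the trial.\<close>

lemma expectation_trial_pmf:
  "measure_pmf.expectation (trial_pmf n A) (\<lambda>x. x) = (frobenius_norm A)\<^sup>2 / tr\<^sup>2"
proof -
  let ?D = "diagonal_pmf n A" and ?a = "map (\<lambda>i. A $$ (i, i)) [0..<n]"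
  let ?X = "\<lambda>(i, j). (A $$ (i, j))\<^sup>2 / (?a ! i * ?a ! j)"
  have "measure_pmf.expectation (trial_pmf n A) (\<lambda>x. x) = measure_pmf.expectation (pair_pmf ?D ?D) ?X"
    by (simp add: trial_pmf_def)
  also have "\<dots> = (\<Sum>k\<in>{..<n} \<times> {..<n}. ?X k * pmf (pair_pmf ?D ?D) k)"
    using set_diagonal_pmf by (intro integral_measure_pmf_real) auto
  also have "\<dots> = (\<Sum>(i, j)\<in>{..<n} \<times> {..<n}. (A $$ (i, j))\<^sup>2 / tr\<^sup>2)"
  proof (intro sum.cong refl)
    fix k
    assume "k \<in> {..<n} \<times> {..<n}"
    then obtain i j where k: "k = (i, j)" and ij: "i < n" "j < n"
      by auto
    \<comment> \<open>Rows with a zero diagonal entry vanish, so that division by 0 does no harm.\<close>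
    have "A $$ (i, j) = 0" if "A $$ (i, i) * A $$ (j, j) = 0"
      using psd_mat_entry_square_le[OF A, of i j] ij that by simp
    then show "?X k * pmf (pair_pmf ?D ?D) k = (case k of (i, j) \<Rightarrow> (A $$ (i, j))\<^sup>2 / tr\<^sup>2)"
      using ij by (auto simp: k pmf_pair pmf_diagonal_pmf power2_eq_square)
  qed
  also have "\<dots> = (\<Sum>i<n. \<Sum>j<n. (A $$ (i, j))\<^sup>2 / tr\<^sup>2)"
    by (rule sum.cartesian_product[symmetric])
  also have "\<dots> = (frobenius_norm A)\<^sup>2 / tr\<^sup>2"
    using A by (simp add: psd_mat_def frobenius_norm_square[of A n] sum_divide_distrib)
  finally show ?thesis .
qed

lemma frobenius_estimate_accuracy:
  assumes \<epsilon>: "0 \<le> \<epsilon>" "\<epsilon> \<le> 1" and s: "0 < s"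
  shows "measure_pmf.prob (frobenius_estimate c n A s)
           {(F, q, a). (1 - \<epsilon>) * (frobenius_norm A)\<^sup>2 \<le> F \<and> F \<le> (1 + \<epsilon>) * (frobenius_norm A)\<^sup>2}
         \<ge> 1 - 2 * exp (- (\<epsilon>\<^sup>2 * s / (3 * n)))"
proof -
  let ?N = "(frobenius_norm A)\<^sup>2"
  let ?S = "{F. (1 - \<epsilon>) * ?N \<le> F \<and> F \<le> (1 + \<epsilon>) * ?N}"
  define \<mu> where "\<mu> = ?N / tr\<^sup>2"
  have tr: "0 < tr"
    unfolding tr_def by (rule psd_mat_trace_pos[OF A nz])
  then have n: "0 < n"
    by (cases "n = 0") (auto simp: tr_def)
  have "tr\<^sup>2 \<le> n * ?N"
    using A trace_square_le_frobenius_norm[of A n] by (simp add: psd_mat_def tr_def)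
  then have "1 / n \<le> \<mu>"
    using tr n by (simp add: \<mu>_def field_simps)
  then have "\<epsilon>\<^sup>2 * s / 3 * (1 / n) \<le> \<epsilon>\<^sup>2 * s / 3 * \<mu>"
    by (intro mult_left_mono) auto
  then have "1 - 2 * exp (- (\<epsilon>\<^sup>2 * s / (3 * n))) \<le> 1 - 2 * exp (- (\<epsilon>\<^sup>2 * (s * \<mu>) / 3))"
    by (simp add: mult_ac)
  also have "\<dots> \<le> measure_pmf.prob (replicate_pmf s (trial_pmf n A))
      {xs. (1 - \<epsilon>) * (s * \<mu>) \<le> sum_list xs \<and> sum_list xs \<le> (1 + \<epsilon>) * (s * \<mu>)}"
    using chernoff_multiplicative[OF set_trial_pmf \<epsilon>, of s] by (simp add: expectation_trial_pmf \<mu>_def)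
  \<comment> \<open>Scaling by tr^2 / s, which is positive, carries the event for the sum over to
    the event for the estimate.\<close>
  also have "{xs. (1 - \<epsilon>) * (s * \<mu>) \<le> sum_list xs \<and> sum_list xs \<le> (1 + \<epsilon>) * (s * \<mu>)}
      = (\<lambda>X. tr\<^sup>2 * (sum_list X / s)) -` ?S"
    using tr s by (auto simp: \<mu>_def field_simps)
  also have "measure_pmf.prob (replicate_pmf s (trial_pmf n A)) \<dots>
      = measure_pmf.prob (map_pmf fst (frobenius_estimate c n A s)) ?S"
    by (simp add: map_fst_frobenius_estimate tr_def)
  also have "\<dots> = measure_pmf.prob (frobenius_estimate c n A s)
      {(F, q, a). (1 - \<epsilon>) * ?N \<le> F \<and> F \<le> (1 + \<epsilon>) * ?N}"
    by (simp add: vimage_def case_prod_beta')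
  finally show ?thesis .
qed

end

section \<open>Costs of the algorithm\<close>

text \<open>A Hoare-style triple for all possible runs: the postcondition P passes facts such as
  list lengths on to later phases, whose costs depend on them.\<close>

definition costs :: "'a costed \<Rightarrow> ('a \<Rightarrow> bool) \<Rightarrow> nat \<Rightarrow> bool" where
  "costs m P k \<longleftrightarrow> (\<forall>(x, q, a) \<in> set_pmf m. P x \<and> q + a \<le> k)"

lemma costs_andthen:
  assumes "costs m P k" "\<And>x. P x \<Longrightarrow> costs (f x) Q l"
  shows "costs (m \<triangleright> f) Q (k + l)"
  using assms unfolding costs_def andthen_def by fastforce

lemma costs_mono:
  assumes "costs m P k" "k \<le> l" "\<And>x. P x \<Longrightarrow> Q x"
  shows "costs m Q l"
  using assms unfolding costs_def by fastforce

lemma costs_primitives: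
  "costs (ret x) (\<lambda>y. y = x) 0"
  "costs (query A i j) (\<lambda>_. True) 1"
  "costs (arith y) (\<lambda>_. True) 1"
  "costs (draw c p) (\<lambda>_. True) c"
  by (auto simp: costs_def ret_def query_def arith_def draw_def)

lemma costs_traverse:
  assumes "\<And>x. costs (f x) (\<lambda>_. True) k"
  shows "costs (traverse f xs) (\<lambda>ys. length ys = length xs) (k * length xs)"
proof (induction xs)
  case Nil
  show ?case
    by (simp add: costs_def ret_def)
next
  case (Cons x xs)
  have "costs (traverse f (x # xs)) (\<lambda>ys. length ys = length (x # xs)) (k + (k * length xs + 0))"
    unfolding traverse.simps
    by (intro costs_andthen[OF assms] costs_andthen[OF Cons.IH] costs_mono[OF costs_primitives(1)]) auto
  then show ?case
    by simp
qed

lemma costs_add_up: "costs (add_up xs) (\<lambda>_. True) (length xs)"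
proof (induction xs)
  case Nil
  show ?case
    by (simp add: costs_def ret_def)
next
  case (Cons x xs)
  show ?case
    using costs_andthen[OF Cons.IH costs_primitives(3)] by simp
qed

text \<open>Two draws at cost c each, one query and three operations.\<close>

lemma costs_trial: "costs (trial c A d D) (\<lambda>_. True) (2 * c + 4)"
proof -
  have "costs (trial c A d D) (\<lambda>_. True) (c + (c + (1 + (1 + (1 + 1)))))"
    unfolding trial_def by (intro costs_andthen[where P = "\<lambda>_. True"] costs_primitives)
  then show ?thesis
    by (rule costs_mono) simp_all
qed

text \<open>Reading, summing and normalizing the diagonal cost n each; every trial costs 2 c + 4 and
  one addition; three operations form the final result.\<close>

lemma costs_frobenius_estimate:
  "costs (frobenius_estimate c n A s) (\<lambda>_. True) (3 * n + (2 * c + 5) * s + 3)"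
proof -
  have "costs (frobenius_estimate c n A s) (\<lambda>_. True)
      (1 * length [0..<n] + (n + (1 * n + ((2 * c + 4) * length [0..<s] + (s + (1 + (1 + 1)))))))"
    unfolding frobenius_estimate_def
  proof (intro costs_andthen[OF costs_traverse[OF costs_primitives(2)]]
      costs_andthen[OF costs_traverse[OF costs_trial]] costs_andthen[where P = "\<lambda>_. True"]
      costs_primitives(3))
    fix d :: "real list"
    assume d: "length d = length [0..<n]"
    then show "costs (add_up d) (\<lambda>_. True) n"
      using costs_add_up[of d] by simp
    show "costs (traverse (\<lambda>x. arith (x / t)) d) (\<lambda>_. True) (1 * n)" for t
      using d costs_traverse[OF costs_primitives(3), of "\<lambda>x. x / t" d] by (simp add: costs_mono)
  next
    fix X :: "real list"
    assume "length X = length [0..<s]"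
    then show "costs (add_up X) (\<lambda>_. True) s"
      using costs_add_up[of X] by simp
  qed
  then show ?thesis
    by (rule costs_mono) (auto simp: algebra_simps)
qed

section \<open>The size of the number of trials\<close>

lemma num_trials_ge: "3 * real n * ln (2 / \<delta>) / \<epsilon>\<^sup>2 \<le> num_trials n \<epsilon> \<delta>"
  unfolding num_trials_def by (rule real_nat_ceiling_ge)

lemma num_trials_le:
  assumes "0 < \<delta>" "\<delta> < 1"
  shows "num_trials n \<epsilon> \<delta> \<le> 3 * real n * ln (2 / \<delta>) / \<epsilon>\<^sup>2 + 1"
proof -
  have "0 \<le> 3 * real n * ln (2 / \<delta>) / \<epsilon>\<^sup>2"
    using assms by simp
  then show ?thesis
    unfolding num_trials_def by (simp add: of_nat_nat)
qed

text \<open>Write ln (2 / \<delta>) as ln 2 + ln (1 / \<delta>); the constant terms are absorbed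
  because ln (1 / \<delta>) is at least the positive number
  \<open>ln (1 / \<delta>\<^sub>0)\<close>. The bound away from 1 matters: ln (1 / \<delta>) tends
  to 0 as \<delta> tends to 1, while the left side stays at least n.\<close>

lemma num_trials_linear_bound:
  assumes n: "1 \<le> n" and \<epsilon>: "0 < \<epsilon>" "\<epsilon> < 1" and \<delta>: "0 < \<delta>" "\<delta> \<le> \<delta>\<^sub>0" "\<delta>\<^sub>0 < 1"
  shows "n + num_trials n \<epsilon> \<delta>
           \<le> (3 + (2 + 3 * ln 2) / ln (1 / \<delta>\<^sub>0)) * (n * ln (1 / \<delta>) / \<epsilon>\<^sup>2)"
proof -
  let ?L = "ln (1 / \<delta>\<^sub>0)"
  have L: "0 < ?L" "?L \<le> ln (1 / \<delta>)"
    using \<delta> by (auto simp: ln_div)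
  then have one: "1 \<le> ln (1 / \<delta>) / ?L"
    by simp
  have le: "real n \<le> n / \<epsilon>\<^sup>2"
    using n \<epsilon> by (simp add: le_divide_eq power_le_one mult_left_le)
  have "n + num_trials n \<epsilon> \<delta> \<le> real n + (3 * real n * ln (2 / \<delta>) / \<epsilon>\<^sup>2 + 1)"
    using num_trials_le[of \<delta> n \<epsilon>] \<delta> by simp
  \<comment> \<open>The 1 from rounding up is at most n, and n \<le> n / \<epsilon>^2.\<close>
  also have "\<dots> \<le> 2 * (n / \<epsilon>\<^sup>2) + 3 * (n / \<epsilon>\<^sup>2) * ln (2 / \<delta>)"
    using n le by simp
  also have "\<dots> = n / \<epsilon>\<^sup>2 * ((2 + 3 * ln 2) + 3 * ln (1 / \<delta>))"
    using \<delta> by (simp add: ln_div diff_divide_distrib ring_distribs mult_ac)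
  also have "\<dots> \<le> n / \<epsilon>\<^sup>2 * ((2 + 3 * ln 2) * (ln (1 / \<delta>) / ?L) + 3 * ln (1 / \<delta>))"
    using mult_left_mono[OF one, of "2 + 3 * ln 2"] by (intro mult_left_mono) auto
  also have "\<dots> = (3 + (2 + 3 * ln 2) / ?L) * (n * ln (1 / \<delta>) / \<epsilon>\<^sup>2)"
    by (simp add: algebra_simps add_divide_distrib)
  finally show ?thesis .
qed

text \<open>The cost bounds hold on every run. The constant of the first one depends on c alone and
  is uniform in the matrix, \<epsilon> and \<delta>; that of the second depends on
  \<open>\<delta>\<^sub>0\<close>, which keeps \<delta> away from 1.\<close>

theorem theorem6:
  fixes c :: nat
  shows
    "(\<forall>(n::nat) (A::real mat) (\<epsilon>::real) (\<delta>::real).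
        psd_mat n A \<and> A \<noteq> 0\<^sub>m n n \<and> 0 < \<epsilon> \<and> \<epsilon> < 1 \<and> 0 < \<delta> \<and> \<delta> < 1 \<longrightarrow>
        measure_pmf.prob (frobenius_estimate c n A (num_trials n \<epsilon> \<delta>))
          {(F, q, a). (1 - \<epsilon>) * (frobenius_norm A)\<^sup>2 \<le> F \<and> F \<le> (1 + \<epsilon>) * (frobenius_norm A)\<^sup>2}
        \<ge> 1 - \<delta>) \<and>
     (\<exists>C::real. \<forall>(n::nat) (A::real mat) (\<epsilon>::real) (\<delta>::real).
        psd_mat n A \<and> A \<noteq> 0\<^sub>m n n \<and> 0 < \<epsilon> \<and> \<epsilon> < 1 \<and> 0 < \<delta> \<and> \<delta> < 1 \<longrightarrow>
        (\<forall>(F, q, a) \<in> set_pmf (frobenius_estimate c n A (num_trials n \<epsilon> \<delta>)).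
           real (q + a) \<le> C * real (n + num_trials n \<epsilon> \<delta>))) \<and>
     (\<forall>\<delta>\<^sub>0::real. 0 < \<delta>\<^sub>0 \<and> \<delta>\<^sub>0 < 1 \<longrightarrow>
        (\<exists>C::real. \<forall>(n::nat) (\<epsilon>::real) (\<delta>::real).
           n \<ge> 1 \<and> 0 < \<epsilon> \<and> \<epsilon> < 1 \<and> 0 < \<delta> \<and> \<delta> \<le> \<delta>\<^sub>0 \<longrightarrow>
           real (n + num_trials n \<epsilon> \<delta>) \<le> C * (real n * ln (1 / \<delta>) / \<epsilon>\<^sup>2)))"
proof (intro conjI allI impI; (elim conjE)?)
  fix n :: nat and A :: "real mat" and \<epsilon> \<delta> :: real
  assume A: "psd_mat n A" "A \<noteq> 0\<^sub>m n n" and \<epsilon>: "0 < \<epsilon>" "\<epsilon> < 1" and \<delta>: "0 < \<delta>" "\<delta> < 1"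
  let ?s = "num_trials n \<epsilon> \<delta>"
  \<comment> \<open>For n = 0 the trace would be an empty sum, but it is positive.\<close>
  have n: "0 < n"
    using psd_mat_trace_pos[OF A] by (cases "n = 0") auto
  have ln: "0 < ln (2 / \<delta>)"
    using \<delta> by simp
  have "0 < 3 * real n * ln (2 / \<delta>) / \<epsilon>\<^sup>2"
    using n ln \<epsilon> by simp
  also note num_trials_ge
  finally have s: "0 < ?s"
    by simp
  \<comment> \<open>The number of trials is chosen for this: each tail then has probability at most
    \<delta> / 2.\<close>
  have "ln (2 / \<delta>) \<le> \<epsilon>\<^sup>2 * ?s / (3 * n)"
    using num_trials_ge[of n \<delta> \<epsilon>] n \<epsilon> by (simp add: field_simps)
  then have "exp (- (\<epsilon>\<^sup>2 * ?s / (3 * n))) \<le> exp (- ln (2 / \<delta>))"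
    by simp
  also have "\<dots> = \<delta> / 2"
    using \<delta> by (simp add: exp_minus)
  finally have "1 - \<delta> \<le> 1 - 2 * exp (- (\<epsilon>\<^sup>2 * ?s / (3 * n)))"
    by simp
  also have "\<dots> \<le> measure_pmf.prob (frobenius_estimate c n A ?s)
      {(F, q, a). (1 - \<epsilon>) * (frobenius_norm A)\<^sup>2 \<le> F \<and> F \<le> (1 + \<epsilon>) * (frobenius_norm A)\<^sup>2}"
    using A \<epsilon> s by (intro frobenius_estimate_accuracy) auto
  finally show "1 - \<delta> \<le> measure_pmf.prob (frobenius_estimate c n A ?s)
      {(F, q, a). (1 - \<epsilon>) * (frobenius_norm A)\<^sup>2 \<le> F \<and> F \<le> (1 + \<epsilon>) * (frobenius_norm A)\<^sup>2}" .
next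
  show "\<exists>C::real. \<forall>(n::nat) (A::real mat) (\<epsilon>::real) (\<delta>::real).
        psd_mat n A \<and> A \<noteq> 0\<^sub>m n n \<and> 0 < \<epsilon> \<and> \<epsilon> < 1 \<and> 0 < \<delta> \<and> \<delta> < 1 \<longrightarrow>
        (\<forall>(F, q, a) \<in> set_pmf (frobenius_estimate c n A (num_trials n \<epsilon> \<delta>)).
           real (q + a) \<le> C * real (n + num_trials n \<epsilon> \<delta>))"
  \<comment> \<open>Since n \<ge> 1, the additive 3 is at most 3 n, so the factor 6 suffices for n
    and 2 c + 5 for the trials; 2 c + 6 dominates both.\<close>
  proof (intro exI[of _ "real (2 * c + 6)"] allI impI; elim conjE; clarify)
    fix n :: nat and A :: "real mat" and \<epsilon> \<delta> F :: real and q a :: nat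
    assume A: "psd_mat n A" "A \<noteq> 0\<^sub>m n n"
      and run: "(F, q, a) \<in> set_pmf (frobenius_estimate c n A (num_trials n \<epsilon> \<delta>))"
    let ?s = "num_trials n \<epsilon> \<delta>"
    have "0 < n"
      using psd_mat_trace_pos[OF A] by (cases "n = 0") auto
    moreover have "q + a \<le> 3 * n + (2 * c + 5) * ?s + 3"
      using costs_frobenius_estimate[of c n A ?s] run by (auto simp: costs_def)
    ultimately have "q + a \<le> 6 * n + (2 * c + 6) * ?s"
      by (simp add: algebra_simps)
    also have "\<dots> \<le> (2 * c + 6) * (n + ?s)"
      by (simp add: algebra_simps)
    finally show "real (q + a) \<le> real (2 * c + 6) * real (n + ?s)"
      unfolding of_nat_mult[symmetric] of_nat_le_iff .
  qed
next
  fix \<delta>\<^sub>0 :: real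
  assume "0 < \<delta>\<^sub>0" "\<delta>\<^sub>0 < 1"
  then show "\<exists>C::real. \<forall>(n::nat) (\<epsilon>::real) (\<delta>::real).
      n \<ge> 1 \<and> 0 < \<epsilon> \<and> \<epsilon> < 1 \<and> 0 < \<delta> \<and> \<delta> \<le> \<delta>\<^sub>0 \<longrightarrow>
      real (n + num_trials n \<epsilon> \<delta>) \<le> C * (real n * ln (1 / \<delta>) / \<epsilon>\<^sup>2)"
    using num_trials_linear_bound by blast
qed

end
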